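(* Let $k\ge 2$ be an integer and let $W_n$ be the wheel graph with $n\ge 3k$. Then $$b_t^{k-1}(W_n)=k.$$
   Context: The wheel $W_n$ is the graph on $n+1$ vertices obtained by joining a single vertex to every vertex of a cycle $C_n$. A total dominating set of a graph without isolated vertices is a vertex set $S$ such that every vertex is adjacent to some vertex of $S$; $\gamma_t(G)$ is the minimum size of such a set. The $k$-total bondage number $b_t^k(G)$ (for $k\ge1$) is the minimum number of edges that must be deleted from $G$ so that the resulting graph (required to have no isolated vertices) has total domination number at least $\gamma_t(G)+k$. *)

theory Defs
  imports Main "HOL-Library.Extended_Nat"
begin

type_synonym 'a graph = "'a set \<times> 'a set set"

definition verts :: "'a graph \<Rightarrow> 'a set" where
  "verts G = fst G"

definition edges :: "'a graph \<Rightarrow> 'a set set" where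
  "edges G = snd G"

definition simple_graph :: "'a graph \<Rightarrow> bool" where
  "simple_graph G \<longleftrightarrow> finite (verts G) \<and> (\<forall>e\<in>edges G. e \<subseteq> verts G \<and> card e = 2)"

definition adjacent :: "'a graph \<Rightarrow> 'a \<Rightarrow> 'a \<Rightarrow> bool" where
  "adjacent G u v \<longleftrightarrow> {u, v} \<in> edges G"

definition no_isolated :: "'a graph \<Rightarrow> bool" where
  "no_isolated G \<longleftrightarrow> (\<forall>v\<in>verts G. \<exists>u\<in>verts G. adjacent G v u)"

definition delete_edges :: "'a graph \<Rightarrow> 'a set set \<Rightarrow> 'a graph" where
  "delete_edges G B = (verts G, edges G - B)"

definition total_dominating :: "'a graph \<Rightarrow> 'a set \<Rightarrow> bool" where
  "total_dominating G S \<longleftrightarrow> S \<subseteq> verts G \<and> (\<forall>v\<in>verts G. \<exists>u\<in>S. adjacent G v u)"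

text \<open>Only meaningful for finite graphs without isolated vertices: these are exactly the
  finite graphs that have a total dominating set.\<close>

definition total_domination_number :: "'a graph \<Rightarrow> nat" where
  "total_domination_number G = (LEAST m. \<exists>S. total_dominating G S \<and> card S = m)"

text \<open>The value is \<open>\<infinity>\<close> if no admissible set of edges exists.\<close>

definition total_bondage_number :: "nat \<Rightarrow> 'a graph \<Rightarrow> enat" where
  "total_bondage_number k G =
     Inf {enat (card B) | B. B \<subseteq> edges G \<and> no_isolated (delete_edges G B) \<and>
        total_domination_number (delete_edges G B) \<ge> total_domination_number G + k}"

definition cycle_graph :: "nat \<Rightarrow> nat graph" where
  "cycle_graph n = ({..<n}, {{i, Suc i mod n} | i. i < n})"

text \<open>The vertex \<open>None\<close> is the hub; the vertices \<open>Some i\<close> form the cycle.\<close>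

definition wheel :: "nat \<Rightarrow> nat option graph" where
  "wheel n =
     (insert None (Some ` verts (cycle_graph n)),
      (\<lambda>e. Some ` e) ` edges (cycle_graph n) \<union> {{None, Some i} | i. i \<in> verts (cycle_graph n)})"

lemma verts_wheel: "verts (wheel n) = insert None (Some ` {..<n})"
  by (simp add: wheel_def verts_def cycle_graph_def)

lemma edges_wheel:
  "edges (wheel n) = {{Some i, Some (Suc i mod n)} | i. i < n} \<union> {{None, Some i} | i. i < n}"
proof -
  have "(\<lambda>e. Some ` e) ` {{i, Suc i mod n} | i. i < n} = {{Some i, Some (Suc i mod n)} | i. i < n}"
    unfolding setcompr_eq_image image_image image_insert image_empty ..
  then show ?thesis
    by (simp only: wheel_def edges_def verts_def cycle_graph_def fst_conv snd_conv lessThan_iff)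
qed

lemma card_verts_wheel: "card (verts (wheel n)) = n + 1"
  by (simp add: verts_wheel card_image)

lemma simple_graph_wheel:
  assumes "n \<ge> 3"
  shows "simple_graph (wheel n)"
proof -
  have "e \<subseteq> verts (wheel n) \<and> card e = 2" if "e \<in> edges (wheel n)" for e
  proof -
    from that consider i where "i < n" "e = {Some i, Some (Suc i mod n)}"
      | i where "i < n" "e = {None, Some i}"
      unfolding edges_wheel by blast
    then show ?thesis
    proof cases
      case 1
      have "i \<noteq> Suc i mod n"
        using 1(1) assms by (cases "Suc i = n") simp_all
      moreover have "Suc i mod n < n"
        using assms by simp
      ultimately show ?thesis
        using 1 by (simp add: verts_wheel)
    next
      case 2
      then show ?thesis by (simp add: verts_wheel)
    qed
  qed
  moreover have "finite (verts (wheel n))"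
    by (simp add: verts_wheel)
  ultimately show ?thesis
    unfolding simple_graph_def by blast
qed

lemma no_isolated_wheel:
  assumes "n \<ge> 3"
  shows "no_isolated (wheel n)"
proof -
  have spoke: "adjacent (wheel n) None (Some i)" if "i < n" for i
    using that unfolding adjacent_def edges_wheel by blast
  have spoke': "adjacent (wheel n) (Some i) None" if "i < n" for i
    using spoke[OF that] unfolding adjacent_def by (simp only: insert_commute)
  have "0 < n" using assms by simp
  then show ?thesis
    unfolding no_isolated_def verts_wheel using spoke spoke' by blast
qed

end

(* Upper bound: delete the spokes at the cycle vertices 1, 4, ..., 3k-2.  Their neighbourhoods
   {3i, 3i+2} are then disjoint, so a total dominating set of size k would consist of exactly one
   vertex of each pair; whichever of 0 and 2 it contains, some vertex nearby stays undominated.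

   Lower bound: after deleting fewer than k edges, take the hub together with one neighbour of each
   cycle vertex that lost its spoke.  This dominates everything but possibly the hub.  If fewer than
   k - 1 spokes were deleted, there is room for one more vertex that kept its spoke; otherwise the
   cycle is intact, and some vertex that lost its spoke has a successor that kept it. *)

theory Submission
  imports Defs
begin

section \<open>Bounds on the total domination number\<close>

lemma total_domination_number_le:
  "total_dominating G S \<Longrightarrow> total_domination_number G \<le> card S"
  unfolding total_domination_number_def by (rule Least_le) blast

lemma total_dominating_verts: "no_isolated G \<Longrightarrow> total_dominating G (verts G)"
  unfolding no_isolated_def total_dominating_def by blast

text \<open>\<open>LEAST\<close> attains its value only if some total dominating set exists;
  \<open>no_isolated\<close> provides one, namely the whole vertex set.\<close>

lemma total_domination_number_ge:
  assumes "no_isolated G" and "\<And>S. total_dominating G S \<Longrightarrow> m \<le> card S"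
  shows "m \<le> total_domination_number G"
proof -
  have "\<exists>m S. total_dominating G S \<and> card S = m"
    using total_dominating_verts[OF assms(1)] by blast
  then have "\<exists>S. total_dominating G S \<and> card S = total_domination_number G"
    unfolding total_domination_number_def by (rule LeastI_ex)
  then show ?thesis
    using assms(2) by metis
qed

text \<open>A member of \<open>S\<close> must itself have a neighbour in \<open>S\<close>, and the
  ends of an edge are distinct.\<close>

lemma total_dominating_card_ge_2:
  assumes "simple_graph G" and "verts G \<noteq> {}" and "total_dominating G S"
  shows "2 \<le> card S"
proof -
  obtain u where u: "u \<in> S"
    using assms(2,3) unfolding total_dominating_def by blast
  then obtain w where w: "w \<in> S" "{u, w} \<in> edges G"
    using assms(3) unfolding total_dominating_def adjacent_def by blast
  have "card {u, w} = 2"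
    using assms(1) w(2) unfolding simple_graph_def by blast
  moreover have "finite S"
    using assms(1,3) unfolding simple_graph_def total_dominating_def by (blast intro: finite_subset)
  ultimately show ?thesis
    using card_mono[of S "{u, w}"] u w(1) by simp
qed

section \<open>Edge deletion and adjacency in the wheel\<close>

lemma verts_delete_edges: "verts (delete_edges G B) = verts G"
  by (simp add: delete_edges_def verts_def)

lemma adjacent_delete_edges: "adjacent (delete_edges G B) u v \<longleftrightarrow> adjacent G u v \<and> {u, v} \<notin> B"
  by (simp add: delete_edges_def adjacent_def edges_def)

lemma adjacent_commute: "adjacent G u v \<longleftrightarrow> adjacent G v u"
  by (simp add: adjacent_def insert_commute)

lemma adjacent_wheel_hub: "adjacent (wheel n) None (Some i) \<longleftrightarrow> i < n"
  unfolding adjacent_def edges_wheel by (auto simp: doubleton_eq_iff)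

lemma adjacent_wheel_hub': "adjacent (wheel n) (Some i) None \<longleftrightarrow> i < n"
  using adjacent_wheel_hub adjacent_commute by metis

lemma adjacent_wheel_None: "\<not> adjacent (wheel n) None None"
  unfolding adjacent_def edges_wheel by (auto simp: doubleton_eq_iff)

lemma adjacent_wheel_rim:
  "adjacent (wheel n) (Some i) (Some j) \<longleftrightarrow> i < n \<and> j = Suc i mod n \<or> j < n \<and> i = Suc j mod n"
  unfolding adjacent_def edges_wheel by (auto simp: doubleton_eq_iff)

lemmas adjacent_wheel =
  adjacent_wheel_hub adjacent_wheel_hub' adjacent_wheel_None adjacent_wheel_rim

lemma Suc_mod_if: "i < n \<Longrightarrow> Suc i mod n = (if Suc i = n then 0 else Suc i)"
  by (simp add: mod_Suc)

lemma total_domination_number_wheel: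
  assumes "n \<ge> 3"
  shows "total_domination_number (wheel n) = 2"
proof (rule antisym)
  have "total_dominating (wheel n) {None, Some 0}"
    using assms unfolding total_dominating_def verts_wheel by (auto simp: adjacent_wheel)
  then show "total_domination_number (wheel n) \<le> 2"
    using total_domination_number_le by fastforce
  show "2 \<le> total_domination_number (wheel n)"
    using assms
    by (intro total_domination_number_ge no_isolated_wheel total_dominating_card_ge_2[OF simple_graph_wheel])
      (auto simp: verts_wheel)
qed

text \<open>Iterating the successor from \<open>t\<close> runs through the whole cycle. Hence a
  nonempty proper subset of the cycle has a member whose successor lies outside it.\<close>

lemma Suc_mod_closed_imp_all:
  fixes T :: "nat set"
  assumes "t \<in> T" and "t < n" and "\<And>i. i \<in> T \<Longrightarrow> Suc i mod n \<in> T" and "j < n"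
  shows "j \<in> T"
proof -
  have shift: "(t + m) mod n \<in> T" for m
  proof (induction m)
    case 0
    then show ?case using assms(1,2) by simp
  next
    case (Suc m)
    then show ?case using assms(3)[OF Suc] by (simp add: mod_Suc_eq)
  qed
  \<comment> \<open>After \<open>n - t\<close> steps the walk is at 0; \<open>j\<close> further
    steps reach \<open>j\<close>.\<close>
  have "(t + (n - t + j)) mod n = j"
    using assms(2,4) by simp
  then show ?thesis
    using shift by metis
qed

section \<open>Upper bound: deleting every third spoke\<close>

definition every_third_spoke :: "nat \<Rightarrow> nat option set set" where
  "every_third_spoke k = (\<lambda>i. {None, Some (3 * i + 1)}) ` {..<k}"

lemma every_third_spoke_hub:
  "{None, Some j} \<in> every_third_spoke k \<longleftrightarrow> (\<exists>i<k. j = 3 * i + 1)"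
  "{Some j, None} \<in> every_third_spoke k \<longleftrightarrow> (\<exists>i<k. j = 3 * i + 1)"
  unfolding every_third_spoke_def by (auto simp: doubleton_eq_iff)

lemma every_third_spoke_rim: "{Some i, Some j} \<notin> every_third_spoke k"
  unfolding every_third_spoke_def by (auto simp: doubleton_eq_iff)

lemma card_every_third_spoke: "card (every_third_spoke k) = k"
  unfolding every_third_spoke_def
  by (subst card_image) (auto simp: inj_on_def doubleton_eq_iff)

lemma every_third_spoke_subset: "3 * k \<le> n \<Longrightarrow> every_third_spoke k \<subseteq> edges (wheel n)"
  unfolding every_third_spoke_def edges_wheel by fastforce

text \<open>The hub keeps its spoke to vertex 0, and the rim is untouched.\<close>

lemma no_isolated_delete_every_third_spoke:
  assumes "n \<ge> 3"
  shows "no_isolated (delete_edges (wheel n) (every_third_spoke k))" (is "no_isolated ?G")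
  unfolding no_isolated_def
proof
  fix v
  assume "v \<in> verts ?G"
  then consider "v = None" | i where "v = Some i" "i < n"
    by (auto simp: verts_delete_edges verts_wheel)
  then show "\<exists>u\<in>verts ?G. adjacent ?G v u"
  proof cases
    case 1
    have "adjacent ?G v (Some 0)"
      using assms 1 by (simp add: adjacent_delete_edges adjacent_wheel every_third_spoke_hub)
    then show ?thesis
      using assms by (auto simp: verts_delete_edges verts_wheel)
  next
    case 2
    then have "adjacent ?G v (Some (Suc i mod n))"
      by (simp add: adjacent_delete_edges adjacent_wheel every_third_spoke_rim)
    then show ?thesis
      using assms by (auto simp: verts_delete_edges verts_wheel)
  qed
qed

lemma total_dominating_delete_every_third_spoke:
  assumes k: "k \<ge> 2" and n: "n \<ge> 3 * k"
    and S: "total_dominating (delete_edges (wheel n) (every_third_spoke k)) S"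
  shows "k < card S"
proof (rule ccontr)
  assume "\<not> k < card S"
  let ?G = "delete_edges (wheel n) (every_third_spoke k)"
  have "finite S"
    using S by (auto simp: total_dominating_def verts_delete_edges verts_wheel intro: finite_subset)
  have dom: "\<exists>u\<in>S. adjacent ?G (Some v) u" if "v < n" for v
    using S that by (auto simp: total_dominating_def verts_delete_edges verts_wheel)
  have "\<exists>j. Some j \<in> S \<and> (j = 3 * i \<or> j = 3 * i + 2)" if i: "i < k" for i
  proof -
    \<comment> \<open>With its spoke deleted, vertex \<open>3 * i + 1\<close> is dominated only
      along the rim; this bound rules out wrap-around at its two neighbours.\<close>
    have lt: "3 * i + 2 < n"
      using i n by linarith
    then obtain u where u: "u \<in> S" "adjacent ?G (Some (3 * i + 1)) u"
      using dom[of "3 * i + 1"] by auto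
    then obtain j where j: "u = Some j"
      using i by (cases u) (auto simp: adjacent_delete_edges every_third_spoke_hub)
    then have "j = Suc (3 * i + 1) mod n \<or> j < n \<and> 3 * i + 1 = Suc j mod n"
      using u(2) by (auto simp: adjacent_delete_edges adjacent_wheel_rim)
    then have "j = 3 * i \<or> j = 3 * i + 2"
      using lt by (auto simp: Suc_mod_if split: if_splits)
    then show ?thesis
      using u(1) j by blast
  qed
  then obtain f where f: "\<And>i. i < k \<Longrightarrow> Some (f i) \<in> S"
      "\<And>i. i < k \<Longrightarrow> f i = 3 * i \<or> f i = 3 * i + 2"
    by metis
  have inj: "inj_on (\<lambda>i. Some (f i)) {..<k}"
  proof (rule inj_onI)
    fix x y
    assume "x \<in> {..<k}" "y \<in> {..<k}" "Some (f x) = Some (f y)"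
    then show "x = y"
      using f(2)[of x] f(2)[of y] by auto
  qed
  \<comment> \<open>The \<open>k\<close> distinct chosen vertices exhaust \<open>S\<close>. In
    particular the hub is not in \<open>S\<close>, so every rim vertex must be dominated along the
    rim.\<close>
  have "(\<lambda>i. Some (f i)) ` {..<k} = S"
    using \<open>finite S\<close> \<open>\<not> k < card S\<close> f(1) by (intro card_seteq) (auto simp: card_image[OF inj])
  then have S_eq: "u \<in> S \<longleftrightarrow> (\<exists>i<k. u = Some (f i))" for u
    by auto
  have rim: "\<exists>j. Some j \<in> S \<and>
      (j = (if Suc v = n then 0 else Suc v) \<or> v = (if Suc j = n then 0 else Suc j))"
    if v: "v < n" for v
  proof -
    obtain u where u: "u \<in> S" "adjacent ?G (Some v) u"
      using dom[OF v] by blast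
    then obtain j where j: "u = Some j"
      by (auto simp: S_eq)
    then have "j = Suc v mod n \<or> j < n \<and> v = Suc j mod n"
      using u(2) by (auto simp: adjacent_delete_edges adjacent_wheel_rim)
    then show ?thesis
      using u(1) j Suc_mod_if[of j n] Suc_mod_if[OF v] by metis
  qed
  have inner: "Some (v - 1) \<in> S \<or> Some (Suc v) \<in> S" if "0 < v" "Suc v < n" for v
    using rim[of v] that by (auto split: if_splits)
  have first: "Some 1 \<in> S \<or> Some (n - 1) \<in> S"
    using rim[of 0] k n by (auto split: if_splits)
  have last: "Some 0 \<in> S \<or> Some (n - 2) \<in> S"
  proof -
    have n2: "0 < n" "\<And>j. n - 1 = Suc j \<Longrightarrow> j = n - 2"
      using k n by linarith+
    then show ?thesis
      using rim[of "n - 1"] by (auto split: if_splits)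
  qed
  \<comment> \<open>All values of \<open>f\<close> are 0 or 2 modulo 3.\<close>
  have not1: "Some (3 * i + 1) \<notin> S" for i
  proof
    assume "Some (3 * i + 1) \<in> S"
    then obtain l where "l < k" "3 * i + 1 = f l"
      by (auto simp: S_eq)
    then show False
      using f(2)[of l] by presburger
  qed
  have only_one: "\<not> (Some 0 \<in> S \<and> Some 2 \<in> S)"
  proof
    assume "Some 0 \<in> S \<and> Some 2 \<in> S"
    then obtain a b where "a < k" "0 = f a" "b < k" "2 = f b"
      by (auto simp: S_eq)
    then show False
      using f(2)[of a] f(2)[of b] by (cases "a = b") auto
  qed
  have "f 0 = 0 \<or> f 0 = 2" "Some (f 0) \<in> S"
    using f[of 0] k by auto
  then consider "Some 0 \<in> S" | "Some 2 \<in> S"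
    by auto
  then show False
  proof cases
    \<comment> \<open>Vertex 2 needs 1 or 3 in \<open>S\<close>, hence 3; then vertex 3 needs 2 or
      4, and both are excluded. Since \<open>k \<ge> 2\<close> gives \<open>n \<ge> 6\<close>,
      neither vertex meets the wrap-around.\<close>
    case 1
    then have "Some 2 \<notin> S"
      using only_one by blast
    moreover from this have "Some 3 \<in> S"
      using inner[of 2] not1[of 0] k n by (simp add: numeral_3_eq_3 numeral_2_eq_2)
    moreover have "Some 2 \<in> S \<or> Some 4 \<in> S"
      using inner[of 3] k n by simp
    ultimately show False
      using not1[of 1] by simp
  next
    \<comment> \<open>Vertex 0 forces \<open>n - 1\<close> into \<open>S\<close>. Values of
      \<open>f\<close> are at most \<open>3 * k - 1\<close>, so \<open>n = 3 * k\<close> and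
      \<open>n - 2\<close> is 1 modulo 3; vertex \<open>n - 1\<close> is then undominated.\<close>
    case 2
    then have "Some 0 \<notin> S"
      using only_one by blast
    have "Some (n - 1) \<in> S"
      using first not1[of 0] by simp
    then obtain l where l: "l < k" "n - 1 = f l"
      by (auto simp: S_eq)
    then have "n - 2 = 3 * (k - 1) + 1"
      using f(2)[of l] n by linarith
    then show False
      using last not1[of "k - 1"] \<open>Some 0 \<notin> S\<close> by metis
  qed
qed

section \<open>Lower bound: deleting fewer than \<open>k\<close> edges\<close>

lemma total_domination_number_delete_less:
  assumes k: "k < n" and B: "finite B" "card B < k" and k2: "2 \<le> k"
    and iso: "no_isolated (delete_edges (wheel n) B)"
  shows "total_domination_number (delete_edges (wheel n) B) \<le> k"
proof -
  let ?G = "delete_edges (wheel n) B"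
  define T where "T = {i. i < n \<and> {None, Some i} \<in> B}"
  have "finite T"
    by (simp add: T_def)
  have inj: "inj_on (\<lambda>i. {None, Some i}) A" for A :: "nat set"
    by (auto simp: inj_on_def doubleton_eq_iff)
  have T_B: "(\<lambda>i. {None, Some i}) ` T \<subseteq> B"
    by (auto simp: T_def)
  have card_T: "card T \<le> card B"
    using card_mono[OF B(1) T_B] by (simp add: card_image[OF inj])
  have spoke: "adjacent ?G None (Some i) \<longleftrightarrow> i < n \<and> i \<notin> T"
    and spoke': "adjacent ?G (Some i) None \<longleftrightarrow> i < n \<and> i \<notin> T" for i
    by (auto simp: adjacent_delete_edges adjacent_wheel T_def insert_commute)
  \<comment> \<open>A vertex without its spoke is not isolated, so it keeps a rim neighbour;
    \<open>g\<close> below selects one.\<close>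
  have "\<exists>j<n. adjacent ?G (Some i) (Some j)" if "i \<in> T" for i
  proof -
    have "Some i \<in> verts ?G"
      using that by (simp add: verts_delete_edges verts_wheel T_def)
    then obtain u where u: "u \<in> verts ?G" "adjacent ?G (Some i) u"
      using iso unfolding no_isolated_def by blast
    then show ?thesis
      using that by (cases u) (auto simp: spoke' verts_delete_edges verts_wheel)
  qed
  then obtain g where g: "\<And>i. i \<in> T \<Longrightarrow> g i < n \<and> adjacent ?G (Some i) (Some (g i))"
    by metis
  \<comment> \<open>The hub dominates the rim outside \<open>T\<close>, \<open>A\<close> dominates
    \<open>T\<close>, and \<open>a\<close> dominates the hub.\<close>
  have td: "total_dominating ?G (insert None (Some ` A))"
    if A: "A \<subseteq> {..<n}" "a \<in> A" "a \<notin> T" and nb: "\<And>i. i \<in> T \<Longrightarrow> \<exists>j\<in>A. adjacent ?G (Some i) (Some j)"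
    for A a
    unfolding total_dominating_def
  proof (intro conjI ballI)
    show "insert None (Some ` A) \<subseteq> verts ?G"
      using A(1) by (auto simp: verts_delete_edges verts_wheel)
    fix v
    assume "v \<in> verts ?G"
    then consider "v = None" | i where "v = Some i" "i < n"
      by (auto simp: verts_delete_edges verts_wheel)
    then show "\<exists>u\<in>insert None (Some ` A). adjacent ?G v u"
    proof cases
      case 1
      then show ?thesis
        using A spoke by blast
    next
      case 2
      then show ?thesis
        using nb[of i] spoke' by (cases "i \<in> T") auto
    qed
  qed
  have bound: "card (insert None (Some ` A)) \<le> Suc (card A)" if "finite A" for A :: "nat set"
    using that by (simp add: card_image)
  have free: "\<exists>a<n. a \<notin> T"
  proof (rule ccontr)
    assume "\<not> ?thesis"
    then have "{..<n} \<subseteq> T"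
      by auto
    then have "n \<le> card T"
      using card_mono[OF \<open>finite T\<close>, of "{..<n}"] by simp
    then show False
      using card_T B(2) k by linarith
  qed
  then obtain a where a: "a < n" "a \<notin> T"
    by blast
  show ?thesis
  proof (cases "Suc (card T) < k")
    case True
    \<comment> \<open>The hub, \<open>a\<close> and the image of \<open>g\<close> number at most
      \<open>card T + 2\<close>, which is at most \<open>k\<close> here.\<close>
    let ?A = "insert a (g ` T)"
    have "total_dominating ?G (insert None (Some ` ?A))"
      using g a by (intro td[of _ a]) auto
    then have "total_domination_number ?G \<le> card (insert None (Some ` ?A))"
      by (rule total_domination_number_le)
    also have "\<dots> \<le> Suc (card ?A)"
      using \<open>finite T\<close> by (intro bound) simp
    also have "card ?A \<le> Suc (card T)"
      using card_image_le[OF \<open>finite T\<close>, of g] card_insert_le_m1[of "Suc (card T)" "g ` T" a] by simp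
    finally show ?thesis
      using True by simp
  next
    case False
    \<comment> \<open>Now \<open>card T \<ge> k - 1 \<ge> card B\<close>, so only spokes were
      deleted, and at least one as \<open>k \<ge> 2\<close>.\<close>
    then have "card T = card B" "card T \<noteq> 0"
      using card_T B(2) k2 by linarith+
    then have B_eq: "(\<lambda>i. {None, Some i}) ` T = B"
      using T_B B(1) by (intro card_seteq) (simp_all add: card_image[OF inj])
    obtain t0 where "t0 \<in> T"
      using \<open>card T \<noteq> 0\<close> by fastforce
    then have "\<exists>t\<in>T. Suc t mod n \<notin> T"
      using Suc_mod_closed_imp_all[of t0 T n a] a by (auto simp: T_def)
    then obtain t where t: "t \<in> T" "Suc t mod n \<notin> T"
      by blast
    then have "t < n"
      by (simp add: T_def)
    have adj: "adjacent ?G (Some t) (Some (Suc t mod n))"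
      using \<open>t < n\<close> by (auto simp: adjacent_delete_edges adjacent_wheel B_eq[symmetric] doubleton_eq_iff)
    \<comment> \<open>Redirecting \<open>g\<close> at \<open>t\<close> to a successor that kept its
      spoke lets one vertex dominate both \<open>t\<close> and the hub, which saves the extra vertex
      \<open>a\<close>.\<close>
    let ?A = "(g(t := Suc t mod n)) ` T"
    have "total_dominating ?G (insert None (Some ` ?A))"
      using g t adj \<open>t < n\<close> by (intro td[of _ "Suc t mod n"]) (auto simp: image_iff)
    then have "total_domination_number ?G \<le> card (insert None (Some ` ?A))"
      by (rule total_domination_number_le)
    also have "\<dots> \<le> Suc (card ?A)"
      using \<open>finite T\<close> by (intro bound) simp
    also have "card ?A \<le> card T"
      by (rule card_image_le[OF \<open>finite T\<close>])
    finally show ?thesis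
      using card_T B(2) by linarith
  qed
qed

theorem theorem3p9:
  fixes k n :: nat
  assumes "k \<ge> 2" and "n \<ge> 3 * k"
  shows "total_bondage_number (k - 1) (wheel n) = enat k"
proof -
  have n3: "n \<ge> 3"
    using assms by linarith
  \<comment> \<open>The wheel has total domination number 2, so the target after deletion is
    \<open>2 + (k - 1)\<close>.\<close>
  have sum: "total_domination_number (wheel n) + (k - 1) = Suc k"
    using assms total_domination_number_wheel[OF n3] by simp
  have fin: "finite (edges (wheel n))"
    unfolding edges_wheel by simp
  show ?thesis
    unfolding total_bondage_number_def sum
  proof (intro antisym Inf_lower Inf_greatest)
    have "Suc k \<le> total_domination_number (delete_edges (wheel n) (every_third_spoke k))"
      using total_dominating_delete_every_third_spoke[OF assms]
      by (intro total_domination_number_ge no_isolated_delete_every_third_spoke n3) (simp add: Suc_le_eq)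
    then show "enat k \<in> {enat (card B) |B. B \<subseteq> edges (wheel n) \<and> no_isolated (delete_edges (wheel n) B) \<and>
        Suc k \<le> total_domination_number (delete_edges (wheel n) B)}"
      using card_every_third_spoke[of k] every_third_spoke_subset[OF assms(2)]
        no_isolated_delete_every_third_spoke[OF n3, of k]
      by (intro CollectI exI[of _ "every_third_spoke k"]) simp
  next
    fix x
    assume "x \<in> {enat (card B) |B. B \<subseteq> edges (wheel n) \<and> no_isolated (delete_edges (wheel n) B) \<and>
        Suc k \<le> total_domination_number (delete_edges (wheel n) B)}"
    then obtain B where B: "x = enat (card B)" "B \<subseteq> edges (wheel n)"
      "no_isolated (delete_edges (wheel n) B)"
      "Suc k \<le> total_domination_number (delete_edges (wheel n) B)"
      by blast
    have "finite B"
      using B(2) fin by (rule finite_subset)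
    moreover have "k < n"
      using assms by linarith
    ultimately have "\<not> card B < k"
      using total_domination_number_delete_less[of k n B] B(3,4) assms(1) by linarith
    then show "enat k \<le> x"
      by (simp add: B(1))
  qed
qed

end
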